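(* Let $a,b,n$ be positive integers with $1\le a<b$, and let $G$ be a finite simple graph with minimum degree $\delta(G)\geq a+n$. If for every $n$-element subset $V'\subset V(G)$ the graph $G-V'$ has an $[a,b]$-factor, then for every $(n-1)$-element subset $V''\subset V(G)$ the graph $G-V''$ also has an $[a,b]$-factor.
   Context: A spanning subgraph $H$ of $G$ is an $[a,b]$-factor if $a\le d_H(x)\le b$ for every $x\in V(G)$. *)

theory Defs
  imports "Graph_Theory.Graph_Theory"
begin

(* Finite simple graphs are the library's locale predicate graph: finite symmetric digraphs
   without loops or parallel arcs. An undirected edge uv is the pair of arcs (u,v), (v,u), so
   the undirected degree of v is the number of arcs leaving v; see degree_eq_card_neighbours. *)

definition degree :: "('a, 'b) pre_digraph \<Rightarrow> 'a \<Rightarrow> nat" where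
  "degree G v = out_degree G v"

lemma degree_eq_card_neighbours:
  assumes "graph G"
  shows "degree G v = card {w. v \<rightarrow>\<^bsub>G\<^esub> w}"
proof -
  interpret graph G by fact
  have "inj_on (head G) (out_arcs G v)"
    by (rule inj_onI) (auto intro!: no_multi_arcs simp: out_arcs_def arc_to_ends_def)
  moreover have "head G ` out_arcs G v = {w. v \<rightarrow>\<^bsub>G\<^esub> w}"
    by (auto simp: out_arcs_def arcs_ends_def arc_to_ends_def)
  ultimately show ?thesis
    unfolding degree_def out_degree_def by (metis card_image)
qed

(* The library admits the null graph, for which this value is unspecified. *)
definition min_degree :: "('a, 'b) pre_digraph \<Rightarrow> nat" where
  "min_degree G = Min (degree G ` verts G)"

definition delete_verts :: "('a, 'b) pre_digraph \<Rightarrow> 'a set \<Rightarrow> ('a, 'b) pre_digraph" where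
  "delete_verts G S = G \<restriction> (verts G - S)"

(* spanning H G only makes H a spanning subdigraph; graph H forces it to contain both
   orientations of each of its edges. *)
definition is_factor ::
  "nat \<Rightarrow> nat \<Rightarrow> ('a, 'b) pre_digraph \<Rightarrow> ('a, 'b) pre_digraph \<Rightarrow> bool" where
  "is_factor a b H G \<longleftrightarrow>
     graph H \<and> spanning H G \<and> (\<forall>x\<in>verts G. a \<le> degree H x \<and> degree H x \<le> b)"

definition has_factor :: "nat \<Rightarrow> nat \<Rightarrow> ('a, 'b) pre_digraph \<Rightarrow> bool" where
  "has_factor a b G \<longleftrightarrow> (\<exists>H. is_factor a b H G)"

end

theory Submission
  imports Defs
begin

text \<open>
  Replacing \<open>G\<close> by \<open>G - V''\<close> reduces to \<open>n = 1\<close>.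
  Suppose that every vertex of \<open>G\<close> has degree at least \<open>a\<close>, that every vertex-deleted subgraph of
  \<open>G\<close> has an \<open>[a,b]\<close>-factor, but that \<open>G\<close> has none. Among the edge sets with all degrees at most
  \<open>b\<close> choose \<open>F\<close> of minimal total deficiency \<open>\<Sum>x. max 0 (a - d\<^sub>F(x))\<close>, and let \<open>u\<close> be
  a deficient vertex. Consider trails from \<open>u\<close> that alternate between edges outside and inside
  \<open>F\<close>, starting outside; let \<open>T\<close> and \<open>S\<close> be the sets of end vertices of such trails of even and
  odd length. Switching \<open>F\<close> along a trail must not lower the deficiency. Hence \<open>d\<^sub>F \<le> a\<close> on \<open>T\<close>,
  and, because \<open>a < b\<close> (this covers closed odd trails), \<open>d\<^sub>F = b\<close> on \<open>S\<close>; so \<open>S\<close> and \<open>T\<close>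
  are disjoint. Every edge of \<open>F\<close> at \<open>S\<close> leads to \<open>T\<close>, and every other edge at \<open>T\<close> leads to \<open>S\<close>.
  Therefore \<open>F\<close> maximises \<open>\<Sum>x\<in>T. d(x) - \<Sum>x\<in>S. d(x)\<close> over all edge sets, the maximum being
  less than \<open>a |T| - b |S|\<close>. If \<open>S\<close> is empty, then all edges at \<open>u\<close> belong to \<open>F\<close>, against the
  degree condition; otherwise a factor of \<open>G - s\<close> with \<open>s \<in> S\<close> has a larger value.
\<close>

section \<open>Degrees in edge sets\<close>

definition edge_degree :: "'a set set \<Rightarrow> 'a \<Rightarrow> nat" where
  "edge_degree F x = card {e \<in> F. x \<in> e}"

lemma edge_degree_insert:
  assumes "finite F" "e \<notin> F"
  shows "edge_degree (insert e F) x = edge_degree F x + of_bool (x \<in> e)"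
proof -
  have "{d \<in> insert e F. x \<in> d} = (if x \<in> e then insert e {d \<in> F. x \<in> d} else {d \<in> F. x \<in> d})"
    by auto
  then show ?thesis
    using assms by (simp add: edge_degree_def)
qed

lemma edge_degree_remove:
  assumes "finite F" "e \<in> F"
  shows "edge_degree F x = edge_degree (F - {e}) x + of_bool (x \<in> e)"
  using edge_degree_insert[of "F - {e}" e x] assms by (simp add: insert_absorb)

text \<open>Double counting of the incidences \<open>x \<in> e\<close>.\<close>

lemma sum_weighted_edge_degree:
  fixes w :: "'a \<Rightarrow> int"
  assumes "finite V" "finite F" "\<And>e. e \<in> F \<Longrightarrow> e \<subseteq> V"
  shows "(\<Sum>x\<in>V. w x * int (edge_degree F x)) = (\<Sum>e\<in>F. \<Sum>x\<in>e. w x)"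
proof -
  have "(\<Sum>x\<in>V. w x * int (edge_degree F x)) = (\<Sum>x\<in>V. \<Sum>e\<in>{e \<in> F. x \<in> e}. w x)"
    by (simp add: edge_degree_def mult.commute)
  also have "\<dots> = (\<Sum>e\<in>F. \<Sum>x\<in>{x \<in> V. x \<in> e}. w x)"
    using assms by (intro sum.swap_restrict) auto
  also have "\<dots> = (\<Sum>e\<in>F. \<Sum>x\<in>e. w x)"
    using assms(3) by (intro sum.cong) (auto intro!: sum.cong)
  finally show ?thesis .
qed

section \<open>Alternating trails\<close>

text \<open>\<open>alt_trail E F u p v D\<close>: some trail in \<open>E\<close> from \<open>u\<close> to \<open>v\<close> with edge set \<open>D\<close> alternates
  between edges outside and inside \<open>F\<close>, starting outside, and has odd length iff \<open>p\<close>.\<close>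

inductive alt_trail :: "'a set set \<Rightarrow> 'a set set \<Rightarrow> 'a \<Rightarrow> bool \<Rightarrow> 'a \<Rightarrow> 'a set set \<Rightarrow> bool"
  for E F u where
  start: "alt_trail E F u False u {}"
| step: "alt_trail E F u p v D \<Longrightarrow> {v, w} \<in> E \<Longrightarrow> {v, w} \<notin> D \<Longrightarrow> v \<noteq> w \<Longrightarrow> {v, w} \<in> F \<longleftrightarrow> p
    \<Longrightarrow> alt_trail E F u (\<not> p) w (insert {v, w} D)"

lemma alt_trail_subset: "alt_trail E F u p v D \<Longrightarrow> D \<subseteq> E"
  by (induction rule: alt_trail.induct) auto

text \<open>Each passage through an inner vertex adds one edge and removes one, so only the two ends
  of the trail count; the last edge is added iff \<open>p\<close>.\<close>

lemma alt_trail_switch_degree: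
  assumes "alt_trail E F u p v D" "finite F"
  shows "finite D \<and> int (edge_degree (sym_diff F D) x) =
    int (edge_degree F x) + of_bool (x = u) + (if p then 1 else -1) * of_bool (x = v)"
  using assms(1)
proof induction
  case start
  then show ?case by simp
next
  case (step p v D w)
  let ?e = "{v, w}" and ?X = "sym_diff F D"
  have fin: "finite ?X" using step.IH assms(2) by simp
  have e: "of_bool (x \<in> ?e) = (of_bool (x = v) + of_bool (x = w) :: int)"
    using \<open>v \<noteq> w\<close> by auto
  have "int (edge_degree (sym_diff F (insert ?e D)) x) =
      int (edge_degree ?X x) + (if p then -1 else 1) * of_bool (x \<in> ?e)"
  proof (cases p)
    case True
    then have eq: "sym_diff F (insert ?e D) = ?X - {?e}" and "?e \<in> ?X"
      using step.hyps by blast+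
    show ?thesis
      unfolding eq edge_degree_remove[OF fin \<open>?e \<in> ?X\<close>] using True by simp
  next
    case False
    then have eq: "sym_diff F (insert ?e D) = insert ?e ?X" and "?e \<notin> ?X"
      using step.hyps by blast+
    show ?thesis
      unfolding eq edge_degree_insert[OF fin \<open>?e \<notin> ?X\<close>] using False by simp
  qed
  then show ?case
    using step.IH unfolding e by (cases p) simp_all
qed

text \<open>The initial segments ending just before and just after \<open>e\<close> have opposite
  parities.\<close>

lemma alt_trail_edge:
  assumes "alt_trail E F u p v D" "e \<in> D"
  shows "\<exists>x y A B. e = {x, y} \<and> alt_trail E F u False x A \<and> alt_trail E F u True y B"
  using assms
proof (induction rule: alt_trail.induct)
  case start
  then show ?case by simp
next
  case (step p v D w)
  show ?case
  proof (cases "e \<in> D")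
    case False
    then have e: "e = {v, w}" using step.prems by simp
    have "alt_trail E F u (\<not> p) w (insert {v, w} D)"
      using step.hyps by (rule alt_trail.step)
    then show ?thesis
      using step.hyps(1) e by (cases p) (auto simp: insert_commute)
  qed (use step.IH in blast)
qed

text \<open>An edge that cannot prolong a trail lies on it already, and then \<open>alt_trail_edge\<close> applies.\<close>

lemma alt_trail_closure:
  assumes "alt_trail E F u p v D" "{v, w} \<in> E" "v \<noteq> w" "{v, w} \<in> F \<longleftrightarrow> p"
    and disjoint: "\<And>x A B. alt_trail E F u False x A \<Longrightarrow> \<not> alt_trail E F u True x B"
  shows "\<exists>D'. alt_trail E F u (\<not> p) w D'"
proof (cases "{v, w} \<in> D")
  case True
  then obtain x y A B where "{v, w} = {x, y}"
      and xy: "alt_trail E F u False x A" "alt_trail E F u True y B"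
    using alt_trail_edge[OF assms(1)] by blast
  then have "(v = x \<and> w = y) \<or> (v = y \<and> w = x)"
    by (auto simp: doubleton_eq_iff)
  \<comment> \<open>By \<open>disjoint\<close>, \<open>v\<close> is reached with parity
    \<open>p\<close> only, which decides whether it is \<open>x\<close> or \<open>y\<close>.\<close>
  then show ?thesis
    using xy assms(1) disjoint by (cases p) auto
next
  case False
  then show ?thesis
    using alt_trail.step[OF assms(1,2) _ assms(3,4)] by blast
qed

section \<open>Factors of vertex-deleted subgraphs\<close>

lemma alt_trail_end_in:
  assumes "alt_trail E F u p v D" "u \<in> V" "\<Union>E \<subseteq> V"
  shows "v \<in> V"
  using assms by (induction rule: alt_trail.induct) auto

text \<open>When \<open>E\<close> is the edge set of a simple graph, these properties make
  \<open>S\<close>, \<open>T\<close> a violating pair for Lovasz's degree criterion: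
  \<open>b * |S|\<close> plus the degrees of \<open>T\<close> outside \<open>S\<close> is less than
  \<open>a * |T|\<close>.\<close>

lemma exists_barrier:
  fixes E :: "'a set set"
  assumes "finite V" "finite E" "\<Union>E \<subseteq> V" "a < b"
    and no_factor: "\<And>F. F \<subseteq> E \<Longrightarrow> \<exists>x\<in>V. \<not> (a \<le> edge_degree F x \<and> edge_degree F x \<le> b)"
  obtains F S T u where "F \<subseteq> E" "S \<subseteq> V" "T \<subseteq> V" "S \<inter> T = {}" "u \<in> T" "edge_degree F u < a"
    "\<And>x. x \<in> T \<Longrightarrow> edge_degree F x \<le> a"
    "\<And>x. x \<in> S \<Longrightarrow> edge_degree F x = b"
    "\<And>x y. x \<in> S \<Longrightarrow> x \<noteq> y \<Longrightarrow> {x, y} \<in> F \<Longrightarrow> y \<in> T"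
    "\<And>x y. x \<in> T \<Longrightarrow> x \<noteq> y \<Longrightarrow> {x, y} \<in> E - F \<Longrightarrow> y \<in> S"
proof -
  define adm where "adm F \<longleftrightarrow> F \<subseteq> E \<and> (\<forall>x\<in>V. edge_degree F x \<le> b)" for F
  define deficiency where "deficiency F = (\<Sum>x\<in>V. a - edge_degree F x)" for F
  have "adm {}" by (simp add: adm_def edge_degree_def)
  then obtain F where F: "adm F" and F_min: "\<And>F'. adm F' \<Longrightarrow> deficiency F \<le> deficiency F'"
    using ex_has_least_nat[of adm _ deficiency] by blast
  have "finite F" using F assms(2) finite_subset by (auto simp: adm_def)
  obtain u where u: "u \<in> V" "edge_degree F u < a"
    using no_factor[of F] F by (force simp: adm_def)
  have no_gain: False
    if "F' \<subseteq> E" "\<And>x. x \<in> V \<Longrightarrow> edge_degree F' x \<le> b"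
      "\<And>x. x \<in> V \<Longrightarrow> a - edge_degree F' x \<le> a - edge_degree F x"
      "edge_degree F' u > edge_degree F u" for F'
  proof -
    have "deficiency F' < deficiency F"
      unfolding deficiency_def
      using that u assms(1) by (intro sum_strict_mono_ex1) (auto intro!: bexI[of _ u])
    with F_min[of F'] that show False by (auto simp: adm_def)
  qed
  have trail_end: "v \<in> V" "sym_diff F D \<subseteq> E" if "alt_trail E F u p v D" for p v D
    using alt_trail_end_in[OF that u(1) assms(3)] alt_trail_subset[OF that] F
    by (auto simp: adm_def)
  have F_le: "edge_degree F x \<le> b" if "x \<in> V" for x
    using F that by (simp add: adm_def)
  have odd: "edge_degree F v = b" if "alt_trail E F u True v D" for v D
  proof (rule ccontr)
    assume "edge_degree F v \<noteq> b"
    then have v: "edge_degree F v < b" using F_le[of v] trail_end[OF that] by linarith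
    have deg: "edge_degree (sym_diff F D) x = edge_degree F x + of_bool (x = u) + of_bool (x = v)"
      for x
      using alt_trail_switch_degree[OF that \<open>finite F\<close>, of x] by (auto split: if_splits)
    \<comment> \<open>If \<open>v = u\<close>, the degree of \<open>u\<close> rises by 2, from at
      most \<open>a - 1\<close> to at most \<open>a + 1 \<le> b\<close>.\<close>
    show False
      using v u F_le \<open>a < b\<close>
      by (intro no_gain[OF trail_end(2)[OF that]]) (auto simp: deg of_bool_def)
  qed
  have even: "edge_degree F v \<le> a" if "alt_trail E F u False v D" for v D
  proof (rule ccontr)
    assume v: "\<not> edge_degree F v \<le> a"
    then have "u \<noteq> v" using u by auto
    \<comment> \<open>Switching moves one unit of degree from \<open>v\<close>, which has more than
      \<open>a\<close>, to the deficient \<open>u\<close>.\<close>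
    have deg: "edge_degree (sym_diff F D) x + of_bool (x = v) = edge_degree F x + of_bool (x = u)"
      for x
      using alt_trail_switch_degree[OF that \<open>finite F\<close>, of x] by (auto split: if_splits)
    show False
    proof (rule no_gain[OF trail_end(2)[OF that]])
      fix x assume "x \<in> V"
      show "edge_degree (sym_diff F D) x \<le> b"
        using deg[of x] F_le[OF \<open>x \<in> V\<close>] u \<open>a < b\<close> by (cases "x = u"; cases "x = v"; simp)
      show "a - edge_degree (sym_diff F D) x \<le> a - edge_degree F x"
        using deg[of x] v by (cases "x = u"; cases "x = v"; simp)
    next
      show "edge_degree F u < edge_degree (sym_diff F D) u"
        using deg[of u] \<open>u \<noteq> v\<close> by simp
    qed
  qed
  have disjoint: "\<not> alt_trail E F u True x B" if "alt_trail E F u False x A" for x A B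
    using odd[of x B] even[OF that] \<open>a < b\<close> by auto
  show thesis
  proof (rule that[of F "{v. \<exists>D. alt_trail E F u True v D}" "{v. \<exists>D. alt_trail E F u False v D}" u])
    show "F \<subseteq> E" using F by (simp add: adm_def)
    fix x y :: 'a assume xy: "x \<noteq> y"
    show "y \<in> {v. \<exists>D. alt_trail E F u False v D}"
      if "x \<in> {v. \<exists>D. alt_trail E F u True v D}" "{x, y} \<in> F"
      using that xy \<open>F \<subseteq> E\<close> alt_trail_closure[of E F u True x _ y] disjoint by fastforce
    show "y \<in> {v. \<exists>D. alt_trail E F u True v D}"
      if "x \<in> {v. \<exists>D. alt_trail E F u False v D}" "{x, y} \<in> E - F"
      using that xy alt_trail_closure[of E F u False x _ y] disjoint by fastforce
  qed (use u odd even disjoint trail_end(1) in \<open>auto intro: alt_trail.start\<close>)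
qed

theorem factor_if_vertex_deleted_factors:
  fixes E :: "'a set set"
  assumes "finite V" and edges: "\<And>e. e \<in> E \<Longrightarrow> \<exists>x\<in>V. \<exists>y\<in>V. x \<noteq> y \<and> e = {x, y}"
    and "a < b" and deg: "\<And>x. x \<in> V \<Longrightarrow> a \<le> edge_degree E x"
    and deleted: "\<And>s. s \<in> V \<Longrightarrow> \<exists>F\<subseteq>E. edge_degree F s = 0 \<and>
      (\<forall>x\<in>V - {s}. a \<le> edge_degree F x \<and> edge_degree F x \<le> b)"
  shows "\<exists>F\<subseteq>E. \<forall>x\<in>V. a \<le> edge_degree F x \<and> edge_degree F x \<le> b"
proof (rule ccontr)
  assume no: "\<not> ?thesis"
  have EV: "\<Union>E \<subseteq> V" using edges by fastforce
  then have "finite E"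
    using \<open>finite V\<close> by (meson finite_UnionD finite_subset)
  have no_factor: "\<exists>x\<in>V. \<not> (a \<le> edge_degree F x \<and> edge_degree F x \<le> b)" if "F \<subseteq> E" for F
    using no that by blast
  show False
  proof (rule exists_barrier[OF \<open>finite V\<close> \<open>finite E\<close> EV \<open>a < b\<close> no_factor])
    fix F S T u
    assume FE: "F \<subseteq> E" and ST: "S \<subseteq> V" "T \<subseteq> V" "S \<inter> T = {}"
      and u: "u \<in> T" "edge_degree F u < a"
      and T: "\<And>x. x \<in> T \<Longrightarrow> edge_degree F x \<le> a"
      and S: "\<And>x. x \<in> S \<Longrightarrow> edge_degree F x = b"
      and F_edge: "\<And>x y. x \<in> S \<Longrightarrow> x \<noteq> y \<Longrightarrow> {x, y} \<in> F \<Longrightarrow> y \<in> T"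
      and nonF_edge: "\<And>x y. x \<in> T \<Longrightarrow> x \<noteq> y \<Longrightarrow> {x, y} \<in> E - F \<Longrightarrow> y \<in> S"
    have "S \<noteq> {}"
    proof
      assume "S = {}"
      have "{e \<in> E. u \<in> e} \<subseteq> {e \<in> F. u \<in> e}"
      proof
        fix e assume e: "e \<in> {e \<in> E. u \<in> e}"
        then obtain y where "e = {u, y}" "u \<noteq> y" using edges[of e] by (auto simp: insert_commute)
        with e show "e \<in> {e \<in> F. u \<in> e}"
          using nonF_edge[OF u(1)] \<open>S = {}\<close> by auto
      qed
      then have "edge_degree E u \<le> edge_degree F u"
                  unfolding edge_degree_def using finite_subset[OF FE \<open>finite E\<close>]
          by (intro card_mono) simp_all
      then show False using deg[of u] u ST by auto
    qed
    then obtain s where s: "s \<in> S" by blast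
    then obtain F' where F': "F' \<subseteq> E" "edge_degree F' s = 0"
        "\<And>x. x \<in> V - {s} \<Longrightarrow> a \<le> edge_degree F' x \<and> edge_degree F' x \<le> b"
      using deleted[of s] ST by blast
    \<comment> \<open>Edges of \<open>F\<close> get total weight at least 0 and all others at most
      0, so \<open>F\<close> maximises the weighted degree sum.\<close>
    define w :: "'a \<Rightarrow> int" where "w x = of_bool (x \<in> T) - of_bool (x \<in> S)" for x
    have fin: "finite F" "finite F'" using FE F' \<open>finite E\<close> finite_subset by auto
    have w_F: "(\<Sum>x\<in>e. w x) \<ge> 0" if "e \<in> F" for e
    proof -
      obtain x y where "e = {x, y}" "x \<noteq> y" using edges[of e] FE \<open>e \<in> F\<close> by blast
      then show ?thesis
        using F_edge[of x y] F_edge[of y x] \<open>e \<in> F\<close> ST(3) by (auto simp: w_def insert_commute)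
    qed
    have w_nonF: "(\<Sum>x\<in>e. w x) \<le> 0" if "e \<in> E - F" for e
    proof -
      obtain x y where "e = {x, y}" "x \<noteq> y" using edges[of e] \<open>e \<in> E - F\<close> by blast
      then show ?thesis
        using nonF_edge[of x y] nonF_edge[of y x] \<open>e \<in> E - F\<close> ST(3)
        by (auto simp: w_def insert_commute)
    qed
    have "(\<Sum>e\<in>F'. \<Sum>x\<in>e. w x) = (\<Sum>e\<in>F' \<inter> F. \<Sum>x\<in>e. w x) + (\<Sum>e\<in>F' - F. \<Sum>x\<in>e. w x)"
      using fin by (metis sum.Int_Diff)
    also have "\<dots> \<le> (\<Sum>e\<in>F' \<inter> F. \<Sum>x\<in>e. w x)"
      using sum_nonpos[of "F' - F" "sum w"] w_nonF F'(1) by fastforce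
    also have "\<dots> \<le> (\<Sum>e\<in>F. \<Sum>x\<in>e. w x)"
      using fin w_F by (intro sum_mono2) auto
    finally have le: "(\<Sum>x\<in>V. w x * int (edge_degree F' x)) \<le> (\<Sum>x\<in>V. w x * int (edge_degree F x))"
      using FE F'(1) EV fin \<open>finite V\<close> by (subst (1 2) sum_weighted_edge_degree) auto
    \<comment> \<open>The opposite comparison holds vertex by vertex: \<open>s\<close> lies in
      \<open>S\<close>, where its degree 0 in \<open>F'\<close> favours \<open>F'\<close>.\<close>
    have "w x * int (edge_degree F x) \<le> w x * int (edge_degree F' x)" if "x \<in> V" for x
    proof (cases "x \<in> S")
      case True
      then have "w x = -1" using ST(3) by (auto simp: w_def)
      moreover have "edge_degree F' x \<le> b"
        using F'(2) F'(3)[of x] that by (cases "x = s") auto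
      ultimately show ?thesis using S[OF True] by simp
    next
      case False
      then have "x \<noteq> s" using s by auto
      then show ?thesis
        using False T[of x] F'(3)[of x] that by (cases "x \<in> T") (auto simp: w_def)
    qed
    moreover have "w u * int (edge_degree F u) < w u * int (edge_degree F' u)"
    proof -
      have "u \<notin> S" "u \<in> V - {s}" using u ST s by auto
      then show ?thesis using u F'(3)[of u] by (simp add: w_def)
    qed
    ultimately have "(\<Sum>x\<in>V. w x * int (edge_degree F x)) < (\<Sum>x\<in>V. w x * int (edge_degree F' x))"
      using u ST \<open>finite V\<close> by (intro sum_strict_mono_ex1) auto
    with le show False by simp
  qed
qed

section \<open>Edge sets of symmetric digraphs\<close>

text \<open>Opposite arcs collapse to one set, so switching never has to keep them paired.\<close>

definition edges :: "('a, 'b) pre_digraph \<Rightarrow> 'a set set" where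
  "edges G = (\<lambda>e. {tail G e, head G e}) ` arcs G"

context graph
begin

lemma finite_edges: "finite (edges G)"
  by (simp add: edges_def)

lemma edges_endpoints: "e \<in> edges G \<Longrightarrow> \<exists>x\<in>verts G. \<exists>y\<in>verts G. x \<noteq> y \<and> e = {x, y}"
  unfolding edges_def using no_loops wellformed by fast

text \<open>By symmetry each edge at \<open>v\<close> comes from an arc leaving \<open>v\<close>,
  and only one, as there are no parallel arcs.\<close>

lemma degree_eq_edge_degree: "degree G v = edge_degree (edges G) v"
proof -
  let ?f = "\<lambda>e. {tail G e, head G e}"
  have "inj_on ?f (out_arcs G v)"
    by (rule inj_onI) (auto intro!: no_multi_arcs simp: out_arcs_def arc_to_ends_def doubleton_eq_iff)
  then have "card (?f ` out_arcs G v) = card (out_arcs G v)"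
    by (rule card_image)
  moreover have "?f ` out_arcs G v = {e \<in> edges G. v \<in> e}"
  proof (intro equalityI subsetI)
    fix e assume "e \<in> {e \<in> edges G. v \<in> e}"
    then obtain c where c: "c \<in> arcs G" "e = ?f c" "v = tail G c \<or> v = head G c"
      by (auto simp: edges_def)
    obtain c' where "c' \<in> arcs G" "tail G c = head G c'" "head G c = tail G c'"
      using sym_arcs c(1) by (auto simp: symmetric_conv)
    with c have "\<exists>d\<in>out_arcs G v. e = ?f d"
      by (auto simp: out_arcs_def intro: bexI[of _ c] bexI[of _ c'])
    then show "e \<in> ?f ` out_arcs G v" by blast
  qed (auto simp: out_arcs_def edges_def)
  ultimately show ?thesis
    by (simp add: degree_def out_degree_def edge_degree_def)
qed

text \<open>Serves both vertex deletion and the passage from an edge set back to a spanning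
  subgraph.\<close>

lemma graph_restrict_arcs:
  assumes "W \<subseteq> verts G" "A \<subseteq> arcs G" "\<And>e. e \<in> A \<Longrightarrow> tail G e \<in> W \<and> head G e \<in> W"
    and "\<And>e. e \<in> A \<Longrightarrow> \<exists>d\<in>A. tail G e = head G d \<and> head G e = tail G d"
  shows "graph \<lparr>verts = W, arcs = A, tail = tail G, head = head G\<rparr>"
  using assms finite_subset[OF assms(1)] finite_subset[OF assms(2)] no_loops no_multi_arcs
  by unfold_locales (auto simp: arc_to_ends_def symmetric_conv subset_iff)

lemma graph_delete_verts: "graph (delete_verts G S)"
  unfolding delete_verts_def induce_subgraph_def
proof (rule graph_restrict_arcs)
  fix e assume "e \<in> {e \<in> arcs G. tail G e \<in> verts G - S \<and> head G e \<in> verts G - S}"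
  moreover from this obtain d where "d \<in> arcs G" "tail G e = head G d" "head G e = tail G d"
    using sym_arcs by (auto simp: symmetric_conv)
  ultimately show "\<exists>d\<in>{e \<in> arcs G. tail G e \<in> verts G - S \<and> head G e \<in> verts G - S}.
      tail G e = head G d \<and> head G e = tail G d"
    by auto
qed auto

lemma edges_delete_verts: "edges (delete_verts G S) = {e \<in> edges G. e \<inter> S = {}}"
  by (auto simp: edges_def delete_verts_def)

lemma has_factor_iff_edges:
  "has_factor a b G \<longleftrightarrow>
    (\<exists>F\<subseteq>edges G. \<forall>x\<in>verts G. a \<le> edge_degree F x \<and> edge_degree F x \<le> b)"
proof
  assume "has_factor a b G"
  then obtain H where H: "graph H" "spanning H G"
      "\<forall>x\<in>verts G. a \<le> degree H x \<and> degree H x \<le> b"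
    by (auto simp: has_factor_def is_factor_def)
  then have "edges H \<subseteq> edges G"
    by (auto simp: edges_def spanning_def subgraph_def compatible_def)
  then show "\<exists>F\<subseteq>edges G. \<forall>x\<in>verts G. a \<le> edge_degree F x \<and> edge_degree F x \<le> b"
    using H graph.degree_eq_edge_degree by metis
next
  assume "\<exists>F\<subseteq>edges G. \<forall>x\<in>verts G. a \<le> edge_degree F x \<and> edge_degree F x \<le> b"
  then obtain F where F: "F \<subseteq> edges G"
      "\<forall>x\<in>verts G. a \<le> edge_degree F x \<and> edge_degree F x \<le> b"
    by blast
  \<comment> \<open>Membership depends on the unordered ends alone, so \<open>?A\<close> is closed
    under reversal.\<close>
  let ?A = "{e \<in> arcs G. {tail G e, head G e} \<in> F}"
  let ?H = "\<lparr>verts = verts G, arcs = ?A, tail = tail G, head = head G\<rparr>"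
  have H: "graph ?H"
  proof (rule graph_restrict_arcs)
    fix e assume "e \<in> ?A"
    moreover from this obtain d where "d \<in> arcs G" "tail G e = head G d" "head G e = tail G d"
      using sym_arcs by (auto simp: symmetric_conv)
    ultimately show "\<exists>d\<in>?A. tail G e = head G d \<and> head G e = tail G d"
      by (auto simp: insert_commute)
  qed auto
  then have "wf_digraph ?H"
    by (simp add: graph_def digraph_def fin_digraph_def)
  then have "spanning ?H G"
    using wf_digraph by (auto simp: spanning_def subgraph_def compatible_def)
  moreover have "edges ?H = F"
    using F(1) by (auto simp: edges_def)
  ultimately show "has_factor a b G"
    unfolding has_factor_def is_factor_def
    using H F(2) graph.degree_eq_edge_degree[OF H] by auto
qed

text \<open>Every edge lost at \<open>x\<close> joins it to a vertex of \<open>S\<close>.\<close>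

lemma edge_degree_delete_verts:
  assumes "S \<subseteq> verts G" "x \<notin> S"
  shows "edge_degree (edges G) x \<le> edge_degree (edges (delete_verts G S)) x + card S"
proof -
  have "finite S" using assms(1) finite_verts by (rule finite_subset)
  have "{e \<in> edges G. x \<in> e} \<subseteq>
      {e \<in> edges (delete_verts G S). x \<in> e} \<union> (\<lambda>s. {x, s}) ` S"
  proof
    fix e assume e: "e \<in> {e \<in> edges G. x \<in> e}"
    then obtain y z where "e = {y, z}" using edges_endpoints by blast
    with e show "e \<in> {e \<in> edges (delete_verts G S). x \<in> e} \<union> (\<lambda>s. {x, s}) ` S"
      using assms(2) by (auto simp: edges_delete_verts insert_commute)
  qed
  then have "edge_degree (edges G) x \<le>
      card ({e \<in> edges (delete_verts G S). x \<in> e} \<union> (\<lambda>s. {x, s}) ` S)"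
    unfolding edge_degree_def using \<open>finite S\<close> finite_edges
    by (intro card_mono) (auto simp: edges_delete_verts)
  also have "\<dots> \<le> edge_degree (edges (delete_verts G S)) x + card ((\<lambda>s. {x, s}) ` S)"
    unfolding edge_degree_def by (rule card_Un_le)
  also have "card ((\<lambda>s. {x, s}) ` S) \<le> card S"
    using \<open>finite S\<close> by (rule card_image_le)
  finally show ?thesis by simp
qed

end

theorem theorem7:
  fixes a b n :: nat and G :: "('a, 'b) pre_digraph"
  assumes "1 \<le> a" and "a < b" and "1 \<le> n"
    and "graph G"
    and "min_degree G \<ge> a + n"
    and "\<And>V'. V' \<subseteq> verts G \<Longrightarrow> card V' = n \<Longrightarrow> has_factor a b (delete_verts G V')"
  shows "\<forall>V''. V'' \<subseteq> verts G \<and> card V'' = n - 1 \<longrightarrow> has_factor a b (delete_verts G V'')"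
proof (intro allI impI)
  interpret graph G by fact
  fix S assume S: "S \<subseteq> verts G \<and> card S = n - 1"
  let ?V = "verts G - S" and ?E = "edges (delete_verts G S)"
  interpret del: graph "delete_verts G S" by (rule graph_delete_verts)
  have verts_del: "verts (delete_verts G X) = verts G - X" for X
    by (simp add: delete_verts_def)
  have "finite S" using S finite_verts finite_subset by blast
  have "\<exists>F\<subseteq>?E. \<forall>x\<in>?V. a \<le> edge_degree F x \<and> edge_degree F x \<le> b"
  proof (rule factor_if_vertex_deleted_factors)
    show "finite ?V" by simp
    show "a < b" by fact
    show "\<exists>x\<in>?V. \<exists>y\<in>?V. x \<noteq> y \<and> e = {x, y}" if "e \<in> ?E" for e
      using del.edges_endpoints[OF that] by (simp add: verts_del)
  next
    fix x assume x: "x \<in> ?V"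
    have "min_degree G \<le> degree G x"
      unfolding min_degree_def using x by (intro Min_le) auto
    then have "a + n \<le> edge_degree (edges G) x"
      using assms(5) degree_eq_edge_degree by simp
    \<comment> \<open>Deleting \<open>n - 1\<close> vertices leaves degree at least
      \<open>a + 1\<close>.\<close>
    then show "a \<le> edge_degree ?E x"
      using edge_degree_delete_verts[of S x] S x by simp
  next
    fix s assume s: "s \<in> ?V"
    let ?D = "delete_verts G (insert s S)"
    interpret D: graph ?D by (rule graph_delete_verts)
    \<comment> \<open>\<open>1 \<le> n\<close> keeps \<open>n - 1\<close> from truncating.\<close>
    have "card (insert s S) = n"
      using s S \<open>finite S\<close> \<open>1 \<le> n\<close> by simp
    then have "has_factor a b ?D" using assms(6) S s by simp
    then obtain F where F: "F \<subseteq> edges ?D"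
        "\<forall>x\<in>verts G - insert s S. a \<le> edge_degree F x \<and> edge_degree F x \<le> b"
      unfolding D.has_factor_iff_edges verts_del by blast
    have "F \<subseteq> ?E" "edge_degree F s = 0"
      using F(1) by (fastforce simp: edges_delete_verts edge_degree_def card_eq_0_iff)+
    then show "\<exists>F\<subseteq>?E. edge_degree F s = 0 \<and>
        (\<forall>x\<in>?V - {s}. a \<le> edge_degree F x \<and> edge_degree F x \<le> b)"
      using F(2) by auto
  qed
  then show "has_factor a b (delete_verts G S)"
    by (simp add: del.has_factor_iff_edges verts_del)
qed

end
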